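(* Define the polynomials $$P_1(X)=X,\qquad P_2(X)=\tfrac32X^2+\tfrac35X+\tfrac{79}{700},\qquad P_3(X)=\tfrac52X^3+\tfrac{12}{5}X^2+\tfrac{647}{700}X+\tfrac{411}{3500},$$ $$P_4(X)=\tfrac{35}{8}X^4+\tfrac{71}{10}X^3+\tfrac{187}{40}X^2+\tfrac{2409}{1750}X+\tfrac{1606257}{10780000},$$ and $R_m(X)=(-1)^mP_m(-X)$ for $1\le m\le4$ (so that $P_m$ and $R_m$ have the same coefficients up to sign, those of $P_m$ being positive and those of $R_m$ alternating in sign). (i) Let $\varepsilon>0$ be such that $\sin(x)\neq0$ and $\sin(x)\neq x$ for all $0<x<\varepsilon$, let $0<x_0<\varepsilon$, and let $x_n=\sin(x_{n-1})$ for $n\ge1$. Then there is a real constant $C$, depending on $x_0$, such that as $n\to\infty$ $$\frac{x_n}{\sqrt3}=\frac1{n^{1/2}}\left\{1+\sum_{m=1}^{4}P_m\left(-\frac12\left[\frac35\ln(n)+C\right]\right)\frac1{n^m}\right\}+o\left(\frac1{n^{9/2}}\right).$$ (ii) Let $\varepsilon>0$ be such that $\operatorname{arcsinh}(x)\neq0$ and $\operatorname{arcsinh}(x)\neq x$ for all $0<x<\varepsilon$, let $0<x_0<\varepsilon$, and let $x_n=\operatorname{arcsinh}(x_{n-1})$ for $n\ge1$. Then there is a real constant $C$, depending on $x_0$, such that as $n\to\infty$ $$\frac{x_n}{\sqrt3}=\frac1{n^{1/2}}\left\{1+\sum_{m=1}^{4}R_m\left(\frac12\left[\frac35\ln(n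)+C\right]\right)\frac1{n^m}\right\}+o\left(\frac1{n^{9/2}}\right).$$
   Context: Here $\ln$ is the natural logarithm, $\operatorname{arcsinh}(x)=\ln\left(x+\sqrt{1+x^2}\right)$, and $n$ ranges over positive integers. The constants $C$ in (i) and (ii) are unrelated. The expansions are asymptotic expansions in the scale $\ln(n)^j/n^{k+1/2}$, truncated after all terms with denominator $n^{9/2}$; the $o(n^{-9/2})$ remainder expresses this. The fact that the two expansions have the same coefficients up to sign is what the paper means by calling $\sin$ and $\operatorname{arcsinh}$ "kindred" functions. *)

theory Defs
  imports
    "HOL-Analysis.Analysis"
    "HOL-Computational_Algebra.Polynomial"
    "HOL-Library.Landau_Symbols"
begin

(* Coefficients are listed from the constant term upwards; only 1 <= m <= 4 is meaningful. *)
definition kindred_P :: "nat \<Rightarrow> real poly" where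
  "kindred_P m =
     (if m = 1 then [:0, 1:]
      else if m = 2 then [:79/700, 3/5, 3/2:]
      else if m = 3 then [:411/3500, 647/700, 12/5, 5/2:]
      else if m = 4 then [:1606257/10780000, 2409/1750, 187/40, 71/10, 35/8:]
      else 0)"

definition kindred_R :: "nat \<Rightarrow> real poly" where
  "kindred_R m = smult ((- 1) ^ m) (kindred_P m \<circ>\<^sub>p [:0, - 1:])"

lemma poly_kindred_R: "poly (kindred_R m) x = (- 1) ^ m * poly (kindred_P m) (- x)"
  by (simp add: kindred_R_def poly_pcompose)

lemma coeff_kindred_R: "coeff (kindred_R m) j = (- 1) ^ (m + j) * coeff (kindred_P m) j"
  by (simp add: kindred_R_def coeff_pcompose_linear power_add)

(* The constant term of the first polynomial is 0, hence not "positive" for all j. *)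
lemma coeff_kindred_P_nonneg: "coeff (kindred_P m) j \<ge> 0"
  by (auto simp: kindred_P_def coeff_pCons split: nat.split)

end

theory Submission
  imports Defs "HOL-Real_Asymp.Real_Asymp"
begin


text \<open>
  Pass from \<open>x\<close> to the large variable \<open>W = 3 / x^2\<close>. One application of \<open>sin\<close> moves \<open>W\<close> to
  \<open>W + 1 + (3/5) / W + (2/7) / W^2 + \<dots>\<close>, and one application of \<open>sinh\<close> moves it by the series that
  arises from this one by conjugation with \<open>W \<mapsto> - W\<close>, since \<open>sin (i x) = i sinh x\<close>. So \<open>arsinh\<close>, the inverse of
  \<open>sinh\<close>, is formally the iteration of \<open>sin\<close> run in negative time; this is why the two expansions
  agree up to signs. A sign \<open>\<sigma>\<close>, equal to 1 for \<open>sin\<close> and to - 1 for \<open>sinh\<close>, treats both at once.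

  A translation-like map is straightened by its Fatou coordinate, a solution \<open>\<phi>\<close> of Abel's equation
  \<open>\<phi> (step W) = \<phi> W + \<sigma>\<close>. The explicit function \<open>fatou \<sigma>\<close> solves this up to \<open>O(W^-5)\<close>. Along an
  orbit the errors are \<open>O(n^-5)\<close>, hence summable with tails \<open>O(n^-4)\<close>, and so
  \<open>fatou \<sigma> (W n) = n + L + O(n^-4)\<close> for a constant \<open>L\<close> (\<open>fatou_orbit\<close>): the constant \<open>C\<close> of the
  theorem is \<open>\<sigma> * L\<close>.

  Then \<open>fatou \<sigma>\<close> has to be inverted. The polynomials \<open>P\<close> provide the truncated formal inverse:
  with \<open>p\<close> the bracket in the claimed expansion, \<open>fatou \<sigma> (n / p^2) = n + L + o(n^-3)\<close>
  (\<open>fatou_inverse_expansion\<close>). As \<open>fatou \<sigma>\<close> is bi-Lipschitz near infinity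
  (\<open>fatou_bilipschitz\<close>), \<open>W n - n / p^2 = o(n^-3)\<close>, and taking inverse square roots, which are
  Lipschitz with constant \<open>O(n^(-3/2))\<close> on this range, gives the error \<open>o(n^(-9/2))\<close>.
\<close>
section \<open>The Fatou coordinate\<close>

text \<open>
  Up to an additive constant these coefficients are forced, one power of \<open>1 / W\<close> after the other, by Abel's equation for
  \<open>step \<sigma>\<close> below. The orbit has to be known up to a relative error \<open>o(n^-4)\<close>, that is, \<open>W\<close> up to
  \<open>o(n^-3)\<close>; this determines where the series stops.
\<close>
definition fatou :: "real \<Rightarrow> real \<Rightarrow> real" where
  "fatou \<sigma> W = W - \<sigma> * (3/5) * ln W + 79/350 / W + \<sigma> * (87/875) / W^2 + 91543/1347500 / W^3"

text \<open>
  The expansion of \<open>3 / (sin x)^2\<close> (for \<open>\<sigma> = 1\<close>) and of \<open>3 / (sinh x)^2\<close> (for \<open>\<sigma> = - 1\<close>) in terms of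
  \<open>W = 3 / x^2\<close>, truncated before order \<open>W^-5\<close>.
\<close>
definition step :: "real \<Rightarrow> real \<Rightarrow> real" where
  "step \<sigma> W = W + \<sigma> + (3/5) / W + \<sigma> * (2/7) / W^2 + (3/25) / W^3 + \<sigma> * (18/385) / W^4"

lemma fatou_has_derivative:
  assumes "W > 0"
  shows "(fatou \<sigma> has_real_derivative
    1 - \<sigma> * (3/5) / W - 79/350 / W^2 - \<sigma> * (174/875) / W^3 - 274629/1347500 / W^4) (at W)"
proof -
  have W: "W \<noteq> 0" using assms by simp
  have power: "((\<lambda>W. c / W^k) has_real_derivative (- real k * c) / W^(Suc k)) (at W)" if "k > 0" for c and k :: nat
  proof -
    have "W ^ (k - 1) * W = W ^ k" using that by (simp flip: power_Suc2)
    then have "(0 * W ^ k - c * (real k * W ^ (k - 1))) / (W ^ k * W ^ k) = (- real k * c) / W^(Suc k)"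
      using W by (simp add: frac_eq_eq)
    then show ?thesis
      using W by (auto intro!: derivative_eq_intros)
  qed
  have "((\<lambda>W. W - \<sigma> * (3/5) * ln W + 79/350 / W^1 + (\<sigma> * (87/875)) / W^2 + 91543/1347500 / W^3)
    has_real_derivative
    1 - \<sigma> * (3/5) * (1 / W) + (- real 1 * (79/350)) / W^Suc 1 + (- real 2 * (\<sigma> * (87/875))) / W^Suc 2
      + (- real 3 * (91543/1347500)) / W^Suc 3) (at W)"
    by (intro DERIV_add DERIV_diff DERIV_cmult DERIV_ident power DERIV_ln_divide assms) auto
  moreover have "fatou \<sigma> = (\<lambda>W. W - \<sigma> * (3/5) * ln W + 79/350 / W^1 + (\<sigma> * (87/875)) / W^2 + 91543/1347500 / W^3)"
    by (simp add: fatou_def fun_eq_iff)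
  ultimately show ?thesis by (simp add: power2_eq_square mult_ac)
qed

lemma fatou_derivative_bounds:
  assumes "\<sigma> = 1 \<or> \<sigma> = -1" "W \<ge> (2::real)"
  shows "1 - \<sigma> * (3/5) / W - 79/350 / W^2 - \<sigma> * (174/875) / W^3 - 274629/1347500 / W^4 \<in> {1/3..2}"
proof -
  define r where "r k = 1 / W^k" for k
  have r: "0 \<le> r k \<and> r k \<le> (1/2)^k" for k
    using power_mono[of "1 / W" "1 / 2" k] frac_le[of 1 1 2 W] assms(2) by (simp add: r_def power_divide)
  have "0 \<le> r 1" "0 \<le> r 2" "0 \<le> r 3" "0 \<le> r 4" "r 1 \<le> 1/2" "r 2 \<le> 1/4" "r 3 \<le> 1/8" "r 4 \<le> 1/16"
    using r[of 1] r[of 2] r[of 3] r[of 4] by (simp_all add: power_divide)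
  note bounds = this
  have "1 - \<sigma> * (3/5) * r 1 - 79/350 * r 2 - \<sigma> * (174/875) * r 3 - 274629/1347500 * r 4 \<in> {1/3..2}"
    using assms(1)
  proof
    assume \<sigma>: "\<sigma> = 1"
    show ?thesis unfolding \<sigma> atLeastAtMost_iff using bounds by (intro conjI; linarith)
  next
    assume \<sigma>: "\<sigma> = -1"
    show ?thesis unfolding \<sigma> atLeastAtMost_iff using bounds by (intro conjI; linarith)
  qed
  then show ?thesis by (simp only: r_def times_divide_eq_right mult_1_right power_one_right)
qed

text \<open>
  The upper bound transfers estimates from \<open>W\<close> to the Fatou coordinate, the lower bound
  transfers them back. By the mean value theorem both follow from bounds on the derivative, which
  for \<open>W \<ge> 2\<close> is still dominated by its leading term 1.
\<close>
lemma fatou_bilipschitz: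
  assumes "\<sigma> = 1 \<or> \<sigma> = -1" "V \<ge> 2" "W \<ge> 2"
  shows "\<bar>V - W\<bar> \<le> 3 * \<bar>fatou \<sigma> V - fatou \<sigma> W\<bar>" "\<bar>fatou \<sigma> V - fatou \<sigma> W\<bar> \<le> 2 * \<bar>V - W\<bar>"
proof -
  have *: "\<bar>V - W\<bar> \<le> 3 * \<bar>fatou \<sigma> V - fatou \<sigma> W\<bar> \<and> \<bar>fatou \<sigma> V - fatou \<sigma> W\<bar> \<le> 2 * \<bar>V - W\<bar>"
    if VW: "2 \<le> V" "V < W" for V W
  proof -
    have "(fatou \<sigma> has_real_derivative
        1 - \<sigma> * (3/5) / z - 79/350 / z^2 - \<sigma> * (174/875) / z^3 - 274629/1347500 / z^4) (at z)"
      if "V \<le> z" "z \<le> W" for z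
      using VW that by (intro fatou_has_derivative) simp
    from MVT2[OF VW(2) this] obtain z where z: "z > V" "z < W" "fatou \<sigma> W - fatou \<sigma> V = (W - V) *
        (1 - \<sigma> * (3/5) / z - 79/350 / z^2 - \<sigma> * (174/875) / z^3 - 274629/1347500 / z^4)"
      by blast
    define D where "D = 1 - \<sigma> * (3/5) / z - 79/350 / z^2 - \<sigma> * (174/875) / z^3 - 274629/1347500 / z^4"
    have D: "1/3 \<le> D" "D \<le> 2"
      using fatou_derivative_bounds[OF assms(1), of z] z VW unfolding D_def by auto
    have "(W - V) * (1/3) \<le> (W - V) * D" "(W - V) * D \<le> (W - V) * 2"
      using VW D by (intro mult_left_mono; simp)+
    then have "(W - V) / 3 \<le> fatou \<sigma> W - fatou \<sigma> V" "fatou \<sigma> W - fatou \<sigma> V \<le> 2 * (W - V)"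
      unfolding z(3) D_def[symmetric] by simp_all
    moreover from this VW have "\<bar>V - W\<bar> = W - V" "\<bar>fatou \<sigma> V - fatou \<sigma> W\<bar> = fatou \<sigma> W - fatou \<sigma> V"
      by simp_all
    ultimately show ?thesis by simp
  qed
  consider "V < W" | "V = W" | "W < V" by linarith
  then have "\<bar>V - W\<bar> \<le> 3 * \<bar>fatou \<sigma> V - fatou \<sigma> W\<bar> \<and> \<bar>fatou \<sigma> V - fatou \<sigma> W\<bar> \<le> 2 * \<bar>V - W\<bar>"
  proof cases
    case 1
    with *[of V W] assms(2) show ?thesis by simp
  next
    case 2
    then show ?thesis by simp
  next
    case 3
    with *[of W V] assms(3) show ?thesis by (simp add: abs_minus_commute)
  qed
  then show "\<bar>V - W\<bar> \<le> 3 * \<bar>fatou \<sigma> V - fatou \<sigma> W\<bar>" "\<bar>fatou \<sigma> V - fatou \<sigma> W\<bar> \<le> 2 * \<bar>V - W\<bar>"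
    by simp_all
qed

lemma fatou_step:
  assumes "\<sigma> = 1 \<or> \<sigma> = -1"
  shows "(\<lambda>W. fatou \<sigma> (step \<sigma> W) - fatou \<sigma> W - \<sigma>) \<in> O[at_top](\<lambda>W. 1 / W^5)"
proof -
  have "(\<lambda>W. fatou 1 (step 1 W) - fatou 1 W - 1) \<in> O[at_top](\<lambda>W. 1 / W^5)"
    unfolding step_def fatou_def by real_asymp
  moreover have "(\<lambda>W. fatou (-1) (step (-1) W) - fatou (-1) W - (-1)) \<in> O[at_top](\<lambda>W. 1 / W^5)"
    unfolding step_def fatou_def by real_asymp
  ultimately show ?thesis using assms by auto
qed

lemma sin_step: "(\<lambda>x. 3 / (sin x)^2 - step 1 (3 / x^2)) \<in> O[at_right 0](\<lambda>x. x^10)"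
  unfolding step_def by real_asymp

text \<open>
  Expanding \<open>sinh\<close> through \<open>exp\<close> inside the quotient is costly because of the cancellations. The
  Taylor polynomial \<open>q\<close> of degree 11 can replace \<open>sinh\<close>: its error \<open>O(x^13)\<close> enters the difference
  \<open>3 / (sinh x)^2 - 3 / (q x)^2\<close> with a factor of order \<open>x^-3\<close>.
\<close>
lemma sinh_step: "(\<lambda>x. 3 / (sinh x)^2 - step (-1) (3 / x^2)) \<in> O[at_right 0](\<lambda>x::real. x^10)"
proof -
  define q :: "real \<Rightarrow> real" where
    "q x = x + x^3/6 + x^5/120 + x^7/5040 + x^9/362880 + x^11/39916800" for x
  have q: "(\<lambda>x. 3 / (q x)^2 - step (-1) (3 / x^2)) \<in> O[at_right 0](\<lambda>x. x^10)"
    unfolding q_def step_def by real_asymp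
  have d: "(\<lambda>x. sinh x - q x) \<in> O[at_right 0](\<lambda>x. x^13)"
    unfolding q_def sinh_field_def by real_asymp
  have sum: "(\<lambda>x. - 3 * (sinh x + q x)) \<in> O[at_right 0](\<lambda>x. x)"
    unfolding q_def sinh_field_def by real_asymp
  have den: "(\<lambda>x. 1 / ((sinh x)^2 * (q x)^2)) \<in> O[at_right 0](\<lambda>x. 1 / x^4)"
    unfolding q_def sinh_field_def by real_asymp
  have "(\<lambda>x. (sinh x - q x) * (- 3 * (sinh x + q x)) * (1 / ((sinh x)^2 * (q x)^2)))
      \<in> O[at_right 0](\<lambda>x. x^13 * x * (1 / x^4))"
    by (intro landau_o.big.mult d sum den)
  also have "(\<lambda>x::real. x^13 * x * (1 / x^4)) \<in> O[at_right 0](\<lambda>x. x^10)"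
    by real_asymp
  finally have e: "(\<lambda>x. (sinh x - q x) * (- 3 * (sinh x + q x)) * (1 / ((sinh x)^2 * (q x)^2)))
      \<in> O[at_right 0](\<lambda>x. x^10)" .
  have "eventually (\<lambda>x::real. x > 0) (at_right 0)"
    by (simp add: eventually_at_right_less)
  then have "eventually (\<lambda>x. (sinh x - q x) * (- 3 * (sinh x + q x)) * (1 / ((sinh x)^2 * (q x)^2))
      = 3 / (sinh x)^2 - 3 / (q x)^2) (at_right 0)"
  proof eventually_elim
    case (elim x)
    have "sinh x \<noteq> 0" "q x \<noteq> 0"
      using elim unfolding q_def by (auto simp: add_pos_pos intro!: less_imp_neq[symmetric] add_pos_pos)
    then show ?case by (simp add: field_simps power2_eq_square)
  qed
  from landau_o.big.in_cong[OF this] e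
  have "(\<lambda>x. 3 / (sinh x)^2 - 3 / (q x)^2) \<in> O[at_right 0](\<lambda>x. x^10)" by simp
  from sum_in_bigo(1)[OF this q] show ?thesis by simp
qed

text \<open>
  Abel's equation holds up to \<open>O(W^-5) = O(x^10)\<close> for the map \<open>f\<close> itself, not only for its truncation
  \<open>step \<sigma>\<close>, because \<open>fatou \<sigma>\<close> is Lipschitz.
\<close>
lemma fatou_increment:
  assumes \<sigma>: "\<sigma> = 1 \<or> \<sigma> = -1"
    and f: "(\<lambda>x. 3 / (f x)^2 - step \<sigma> (3 / x^2)) \<in> O[at_right 0](\<lambda>x. x^10)"
  shows "(\<lambda>x. fatou \<sigma> (3 / (f x)^2) - fatou \<sigma> (3 / x^2) - \<sigma>) \<in> O[at_right 0](\<lambda>x. x^10)"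
proof -
  have W: "filterlim (\<lambda>x::real. 3 / x^2) at_top (at_right 0)" by real_asymp
  have step: "filterlim (step \<sigma>) at_top at_top"
  proof -
    have "filterlim (step 1) at_top at_top" "filterlim (step (-1)) at_top at_top"
      unfolding step_def by real_asymp+
    then show ?thesis using \<sigma> by auto
  qed
  have V: "filterlim (\<lambda>x. step \<sigma> (3 / x^2)) at_top (at_right 0)"
    by (rule filterlim_compose[OF step W])
  have "((\<lambda>x. 3 / (f x)^2 - step \<sigma> (3 / x^2)) \<longlongrightarrow> 0) (at_right 0)"
  proof -
    have "(\<lambda>x::real. x^10) \<in> o[at_right 0](\<lambda>_. 1)" by real_asymp
    from smalloD_tendsto[OF landau_o.big_small_trans[OF f this]] show ?thesis by simp
  qed
  from filterlim_tendsto_add_at_top[OF this V]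
  have V': "filterlim (\<lambda>x. 3 / (f x)^2) at_top (at_right 0)" by simp
  have "eventually (\<lambda>x. step \<sigma> (3 / x^2) \<ge> 2) (at_right 0)" "eventually (\<lambda>x. 3 / (f x)^2 \<ge> 2) (at_right 0)"
    using V V' by (auto simp: filterlim_at_top)
  then have "eventually (\<lambda>x. norm (fatou \<sigma> (3 / (f x)^2) - fatou \<sigma> (step \<sigma> (3 / x^2)))
     \<le> 2 * norm (3 / (f x)^2 - step \<sigma> (3 / x^2))) (at_right 0)"
    by eventually_elim (use fatou_bilipschitz(2)[OF \<sigma>] in auto)
  then have "(\<lambda>x. fatou \<sigma> (3 / (f x)^2) - fatou \<sigma> (step \<sigma> (3 / x^2))) \<in> O[at_right 0](\<lambda>x. 3 / (f x)^2 - step \<sigma> (3 / x^2))"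
    by (rule bigoI)
  then have 1: "(\<lambda>x. fatou \<sigma> (3 / (f x)^2) - fatou \<sigma> (step \<sigma> (3 / x^2))) \<in> O[at_right 0](\<lambda>x. x^10)"
    using f landau_o.big_trans by blast
  have "(\<lambda>x. fatou \<sigma> (step \<sigma> (3 / x^2)) - fatou \<sigma> (3 / x^2) - \<sigma>) \<in> O[at_right 0](\<lambda>x. 1 / (3 / x^2)^5)"
    by (rule landau_o.big.compose[OF fatou_step[OF \<sigma>] W])
  also have "(\<lambda>x::real. 1 / (3 / x^2)^5) \<in> O[at_right 0](\<lambda>x. x^10)" by real_asymp
  finally have 2: "(\<lambda>x. fatou \<sigma> (step \<sigma> (3 / x^2)) - fatou \<sigma> (3 / x^2) - \<sigma>) \<in> O[at_right 0](\<lambda>x. x^10)" .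
  have "fatou \<sigma> (3 / (f x)^2) - fatou \<sigma> (3 / x^2) - \<sigma> = (fatou \<sigma> (3 / (f x)^2) - fatou \<sigma> (step \<sigma> (3 / x^2)))
      + (fatou \<sigma> (step \<sigma> (3 / x^2)) - fatou \<sigma> (3 / x^2) - \<sigma>)" for x by simp
  with sum_in_bigo(1)[OF 1 2] show ?thesis by (simp only:)
qed

section \<open>Orbits in the Fatou coordinate\<close>

text \<open>
  The increments are dominated by those of \<open>1 / n^4\<close>, since \<open>1 / n^4 - 1 / (n + 1)^4\<close> is asymptotically
  \<open>4 / n^5\<close>; so the sequence is Cauchy and approaches its limit at the rate \<open>1 / n^4\<close>.
\<close>
lemma telescoping_limit:
  fixes b :: "nat \<Rightarrow> real"
  assumes "(\<lambda>n. b (Suc n) - b n) \<in> O(\<lambda>n. 1 / real n ^ 5)"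
  shows "\<exists>L. (\<lambda>n. b n - L) \<in> O(\<lambda>n. 1 / real n ^ 4)"
proof -
  obtain K where K: "K > 0" "eventually (\<lambda>n. norm (b (Suc n) - b n) \<le> K * norm (1 / real n ^ 5)) at_top"
    using assms by (rule landau_o.bigE)
  have "eventually (\<lambda>n. 1 / real n ^ 5 \<le> 1 / real n ^ 4 - 1 / real (Suc n) ^ 4) at_top"
    by real_asymp
  with K(2) have "eventually (\<lambda>n. \<bar>b (Suc n) - b n\<bar> \<le> K / real n ^ 4 - K / real (Suc n) ^ 4) at_top"
  proof eventually_elim
    case (elim n)
    have "K * (1 / real n ^ 5) \<le> K * (1 / real n ^ 4 - 1 / real (Suc n) ^ 4)"
      using K(1) elim(2) by (intro mult_left_mono) auto
    then show ?case using elim(1) by (simp add: algebra_simps)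
  qed
  then obtain N where N: "\<And>n. n \<ge> N \<Longrightarrow> \<bar>b (Suc n) - b n\<bar> \<le> K / real n ^ 4 - K / real (Suc n) ^ 4"
    unfolding eventually_at_top_linorder by blast
  have tail: "\<bar>b m - b n\<bar> \<le> K / real n ^ 4 - K / real m ^ 4" if "N \<le> n" "n \<le> m" for m n
    using that(2)
  proof (induction m rule: dec_induct)
    case (step m)
    then show ?case using N[of m] that(1) by simp
  qed simp
  have lim: "(\<lambda>n. K / real n ^ 4) \<longlonglongrightarrow> 0" by real_asymp
  have "Cauchy b"
  proof (rule metric_CauchyI)
    fix e :: real assume e: "e > 0"
    from order_tendstoD(2)[OF lim e] obtain M where M: "\<And>n. n \<ge> M \<Longrightarrow> K / real n ^ 4 < e"
      unfolding eventually_at_top_linorder by blast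
    have "dist (b m) (b n) < e" if mn: "m \<ge> max N M" "n \<ge> max N M" for m n
    proof -
      have pos: "K / real j ^ 4 \<ge> 0" for j using K(1) by simp
      show ?thesis
        using tail[of m n] tail[of n m] M[of n] M[of m] mn pos[of m] pos[of n]
        by (cases "m \<le> n") (auto simp: dist_real_def abs_minus_commute)
    qed
    then show "\<exists>M. \<forall>m\<ge>M. \<forall>n\<ge>M. dist (b m) (b n) < e" by blast
  qed
  then obtain L where L: "b \<longlonglongrightarrow> L" by (auto simp: Cauchy_convergent_iff convergent_def)
  have "\<bar>b n - L\<bar> \<le> K / real n ^ 4" if n: "n \<ge> N" for n
  proof (rule tendsto_upperbound)
    show "(\<lambda>m. \<bar>b n - b m\<bar>) \<longlonglongrightarrow> \<bar>b n - L\<bar>" by (intro tendsto_intros L)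
    show "eventually (\<lambda>m. \<bar>b n - b m\<bar> \<le> K / real n ^ 4) at_top"
      using eventually_ge_at_top[of n]
    proof eventually_elim
      case (elim m)
      have "K / real m ^ 4 \<ge> 0" using K(1) by simp
      then show ?case using tail[OF n elim] by (simp add: abs_minus_commute)
    qed
  qed simp
  then have "eventually (\<lambda>n. norm (b n - L) \<le> K * norm (1 / real n ^ 4)) at_top"
    unfolding eventually_at_top_linorder by (intro exI[of _ N]) auto
  then show ?thesis by (blast intro: bigoI)
qed

text \<open>
  The increments of the Fatou coordinate along the orbit tend to 1, so it grows at least like
  \<open>n / 4\<close>, and so \<open>W\<close> is at least \<open>n / 8\<close>. This first crude rate turns the error \<open>O(x^10)\<close> into \<open>O(1 / n^5)\<close>, for which the
  telescoping argument yields the constant.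
\<close>
lemma fatou_orbit:
  fixes x :: "nat \<Rightarrow> real"
  assumes \<sigma>: "\<sigma> = 1 \<or> \<sigma> = -1"
    and pos: "\<And>n. x n > 0" and lim: "x \<longlonglongrightarrow> 0"
    and inc: "(\<lambda>n. fatou \<sigma> (3 / (x (Suc n))^2) - fatou \<sigma> (3 / (x n)^2) - 1) \<in> O(\<lambda>n. x n ^ 10)"
  shows "\<exists>L. (\<lambda>n. fatou \<sigma> (3 / (x n)^2) - real n - L) \<in> O(\<lambda>n. 1 / real n ^ 4)"
    and "eventually (\<lambda>n. 3 / (x n)^2 \<ge> real n / 8) at_top"
proof -
  define W where "W n = 3 / (x n)^2" for n
  define \<phi> where "\<phi> n = fatou \<sigma> (W n)" for n
  have W0: "W n > 0" for n using pos[of n] by (simp add: W_def)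
  have xlim: "filterlim x (at_right 0) at_top"
    using lim by (simp add: filterlim_at pos pos[THEN less_imp_neq, THEN not_sym])
  have "filterlim (\<lambda>x::real. 3 / x^2) at_top (at_right 0)" by real_asymp
  from filterlim_compose[OF this xlim] have Wlim: "filterlim W at_top at_top" by (simp add: W_def[abs_def])
  have "(\<lambda>x::real. x^10) \<in> o[at_right 0](\<lambda>_. 1)" by real_asymp
  from landau_o.small.compose[OF this xlim]
  have "(\<lambda>n. x n ^ 10) \<in> o(\<lambda>_. 1)" .
  from smalloD_tendsto[OF landau_o.big_small_trans[OF inc this]]
  have "(\<lambda>n. \<phi> (Suc n) - \<phi> n - 1) \<longlonglongrightarrow> 0" by (simp add: \<phi>_def W_def)
  from order_tendstoD(1)[OF this, of "-1/2"]
  obtain N where N: "\<And>n. n \<ge> N \<Longrightarrow> \<phi> (Suc n) \<ge> \<phi> n + 1/2"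
    unfolding eventually_at_top_linorder by force
  have lin: "\<phi> n \<ge> \<phi> N + (real n - real N) / 2" if "n \<ge> N" for n
    using that
  proof (induction n rule: dec_induct)
    case (step n)
    then show ?case using N[of n] by (simp add: field_simps)
  qed simp
  have "eventually (\<lambda>W. fatou 1 W \<le> 2 * W) at_top" "eventually (\<lambda>W. fatou (-1) W \<le> 2 * W) at_top"
    unfolding fatou_def by real_asymp+
  then have "eventually (\<lambda>W. fatou \<sigma> W \<le> 2 * W) at_top" using \<sigma> by auto
  then have "eventually (\<lambda>n. \<phi> n \<le> 2 * W n) at_top"
    unfolding \<phi>_def by (rule eventually_compose_filterlim[OF _ Wlim])
  moreover have "eventually (\<lambda>n. \<phi> N + (real n - real N) / 2 \<ge> real n / 4) at_top"
    by real_asymp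
  moreover have "eventually (\<lambda>n. n \<ge> N) at_top" by (rule eventually_ge_at_top)
  ultimately have growth: "eventually (\<lambda>n. W n \<ge> real n / 8) at_top"
  proof eventually_elim
    case (elim n)
    with lin[of n] show ?case by linarith
  qed
  then show "eventually (\<lambda>n. 3 / (x n)^2 \<ge> real n / 8) at_top" by (simp add: W_def)
  have "eventually (\<lambda>n. norm (x n ^ 10) \<le> 24^5 * norm (1 / real n ^ 5)) at_top"
    using growth eventually_gt_at_top[of 0]
  proof eventually_elim
    case (elim n)
    have "(x n)^2 = 3 / W n" using pos[of n] by (simp add: W_def)
    also have "\<dots> \<le> 24 / real n" using elim W0[of n] by (simp add: field_simps)
    finally have "((x n)^2)^5 \<le> (24 / real n)^5" by (rule power_mono) simp
    then show ?case by (simp add: power_divide flip: power_mult)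
  qed
  then have "(\<lambda>n. x n ^ 10) \<in> O(\<lambda>n. 1 / real n ^ 5)" by (rule bigoI)
  with inc have "(\<lambda>n. fatou \<sigma> (3 / (x (Suc n))^2) - fatou \<sigma> (3 / (x n)^2) - 1) \<in> O(\<lambda>n. 1 / real n ^ 5)"
    using landau_o.big_trans by blast
  then have "(\<lambda>n. (\<phi> (Suc n) - real (Suc n)) - (\<phi> n - real n)) \<in> O(\<lambda>n. 1 / real n ^ 5)"
    by (simp add: \<phi>_def W_def diff_diff_eq add.commute)
  from telescoping_limit[OF this]
  show "\<exists>L. (\<lambda>n. fatou \<sigma> (3 / (x n)^2) - real n - L) \<in> O(\<lambda>n. 1 / real n ^ 4)"
    by (simp add: \<phi>_def W_def)
qed

section \<open>The formal inverse of the Fatou coordinate\<close>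

text \<open>
  Written with \<open>u = \<sigma> / n\<close> and \<open>l = 3/5 * ln n + C\<close>, the bracket in the claimed expansion is
  \<open>1 + u * correction l u\<close>. In these variables the signs of the two cases disappear.
\<close>
definition correction :: "real \<Rightarrow> real \<Rightarrow> real" where
  "correction l u = (let a = (\<lambda>m. poly (kindred_P m) (- (1/2) * l)) in a 1 + u * (a 2 + u * (a 3 + u * a 4)))"

lemma correction_eq_sum: "u * correction l u = (\<Sum>m=1..4. poly (kindred_P m) (- (1/2) * l) * u ^ m)"
  by (simp add: correction_def Let_def numeral_eq_Suc algebra_simps)

text \<open>
  What remains of \<open>\<sigma> * (fatou \<sigma> (t / (1 + u * v)^2) - t) - C\<close>, for \<open>u = \<sigma> / t\<close> and \<open>l = 3/5 * ln t + C\<close>,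
  after \<open>1 / (1 + s)^2\<close> and \<open>ln (1 + s)\<close> at \<open>s = u * v\<close> have been replaced by their Taylor
  polynomials and all terms with a factor \<open>u^4\<close> have been dropped.
\<close>
definition inversion_defect :: "real \<Rightarrow> real \<Rightarrow> real \<Rightarrow> real" where
  "inversion_defect l u v = - 2 * v - l + u * (3 * v^2 + 6/5 * v + 79/350)
     + u^2 * (- 4 * v^3 - 3/5 * v^2 + 79/175 * v + 87/875)
     + u^3 * (5 * v^4 + 2/5 * v^3 + 79/350 * v^2 + 348/875 * v + 91543/1347500)"

text \<open>
  This is where the polynomials \<open>P\<close> come from: the coefficients of \<open>u^0\<close> to \<open>u^3\<close> in the defect are
  linear in \<open>a 1\<close>, \<open>a 2\<close>, \<open>a 3\<close> and \<open>a 4\<close> in turn, and their vanishing determines these one by one.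
  The quotient by \<open>u^4\<close> is given explicitly, but all that matters is that it is a polynomial
  in \<open>u\<close> and \<open>l\<close>. The Horner remainders \<open>w1\<close> and \<open>w2\<close> keep it short.
\<close>
lemma inversion_defect_correction:
  fixes l u :: real
  defines "a m \<equiv> poly (kindred_P m) (- (1/2) * l)"
  defines "w2 \<equiv> a 3 + u * a 4"
  defines "w1 \<equiv> a 2 + u * w2"
  defines "v \<equiv> correction l u"
  shows "inversion_defect l u v = u^4 *
    (a 4 * (6 * a 1 + 6/5) + 3 * w2 * (w1 + a 2)
      + w2 * (- 4 * (v^2 + v * a 1 + a 1^2) - 3/5 * (v + a 1) + 79/175)
      + a 2 * w1 * (- 4 * (v + 2 * a 1) - 3/5)
      + w1 * (5 * (v^3 + v^2 * a 1 + v * a 1^2 + a 1^3) + 2/5 * (v^2 + v * a 1 + a 1^2) + 79/350 * (v + a 1) + 348/875))"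
    (is "_ = u^4 * ?Q")
proof -
  have v: "v = a 1 + u * w1"
    by (simp add: v_def w1_def w2_def correction_def a_def)
  have 0: "- 2 * a 1 - l = 0" by (simp add: a_def kindred_P_def)
  have 1: "- 2 * a 2 + 3 * a 1^2 + 6/5 * a 1 + 79/350 = 0"
    by (simp add: a_def kindred_P_def field_simps eval_nat_numeral)
  have 2: "- 2 * a 3 + a 2 * (6 * a 1 + 6/5) - 4 * a 1^3 - 3/5 * a 1^2 + 79/175 * a 1 + 87/875 = 0"
    by (simp add: a_def kindred_P_def field_simps eval_nat_numeral)
  have 3: "- 2 * a 4 + a 3 * (6 * a 1 + 6/5) + 3 * a 2^2 + a 2 * (- 12 * a 1^2 - 6/5 * a 1 + 79/175)
      + 5 * a 1^4 + 2/5 * a 1^3 + 79/350 * a 1^2 + 348/875 * a 1 + 91543/1347500 = 0"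
    by (simp add: a_def kindred_P_def field_simps eval_nat_numeral)
  have "inversion_defect l u v - u^4 * ?Q
    = (- 2 * a 1 - l) + u * (- 2 * a 2 + 3 * a 1^2 + 6/5 * a 1 + 79/350)
     + u^2 * (- 2 * a 3 + a 2 * (6 * a 1 + 6/5) - 4 * a 1^3 - 3/5 * a 1^2 + 79/175 * a 1 + 87/875)
     + u^3 * (- 2 * a 4 + a 3 * (6 * a 1 + 6/5) + 3 * a 2^2 + a 2 * (- 12 * a 1^2 - 6/5 * a 1 + 79/175)
      + 5 * a 1^4 + 2/5 * a 1^3 + 79/350 * a 1^2 + 348/875 * a 1 + 91543/1347500)"
    unfolding inversion_defect_def v w1_def w2_def by algebra
  then show ?thesis
    unfolding 0 1 2 3 by simp
qed

definition log_remainder :: "real \<Rightarrow> real" where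
  "log_remainder s = ln (1 + s) - (s - s^2/2 + s^3/3)"

text \<open>
  The identity is exact, with \<open>v\<close> not yet specialised: the Taylor polynomial of \<open>1 / (1 + s)^2\<close> has the closed
  remainder \<open>- s^5 * (6 + 5 * s) / (1 + s)^2\<close>, and the powers of \<open>\<sigma>\<close> are absorbed into those of \<open>u\<close>
  because \<open>\<sigma>\<close> is its own inverse.
\<close>
lemma fatou_at_candidate:
  fixes \<sigma> t C v :: real
  assumes \<sigma>: "\<sigma> = 1 \<or> \<sigma> = -1" and t: "t > 0"
  defines "u \<equiv> \<sigma> / t" and "l \<equiv> 3/5 * ln t + C"
  assumes p: "1 + u * v > 0"
  shows "fatou \<sigma> (t / (1 + u * v)^2) - t - \<sigma> * C = \<sigma> * (inversion_defect l u v
    + u^4 * (87/875 * v^2 * (6 + 4 * (u * v) + (u * v)^2)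
        + 91543/1347500 * v * (6 + 15 * (u * v) + 20 * (u * v)^2 + 15 * (u * v)^3 + 6 * (u * v)^4 + (u * v)^5)
        - v^5 * (6 + 5 * (u * v)) / (1 + u * v)^2)
    + 6/5 * log_remainder (u * v))"
proof -
  define s where "s = u * v"
  have s: "1 + s > 0" using p by (simp add: s_def)
  have \<sigma>2: "\<sigma> * \<sigma> = 1" using \<sigma> by auto
  have tu: "t * u = \<sigma>" using t by (simp add: u_def)
  have inv: "1 / (1 + s)^2 = 1 - 2 * s + 3 * s^2 - 4 * s^3 + 5 * s^4 - s^5 * (6 + 5 * s) / (1 + s)^2"
  proof -
    have "(1 - 2 * s + 3 * s^2 - 4 * s^3 + 5 * s^4) * (1 + s)^2 = 1 + s^5 * (6 + 5 * s)" by algebra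
    then show ?thesis using s by (simp add: field_simps)
  qed
  have tinv: "t / (1 + s)^2 = t - 2 * \<sigma> * v + 3 * \<sigma> * u * v^2 - 4 * \<sigma> * u^2 * v^3 + 5 * \<sigma> * u^3 * v^4
      - \<sigma> * u^4 * (v^5 * (6 + 5 * s) / (1 + s)^2)"
  proof -
    have "t / (1 + s)^2 = t * (1 / (1 + s)^2)" by simp
    also have "\<dots> = t - 2 * (t * u) * v + 3 * (t * u) * u * v^2 - 4 * (t * u) * u^2 * v^3 + 5 * (t * u) * u^3 * v^4
      - (t * u) * u^4 * (v^5 * (6 + 5 * s) / (1 + s)^2)"
      unfolding inv
      by (simp add: s_def algebra_simps eval_nat_numeral)
    finally show ?thesis by (simp only: tu)
  qed
  have ln: "ln (t / (1 + s)^2) = ln t - 2 * (s - s^2/2 + s^3/3 + log_remainder s)"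
    using s t by (simp add: ln_div ln_realpow log_remainder_def)
  have u1: "1 / t = \<sigma> * u" using \<sigma>2 t by (simp add: u_def field_simps)
  have *: "c / (t / (1 + s)^2)^k = c * (1 / t)^k * (1 + s)^(2 * k)" for c and k :: nat
    using s t by (simp add: power_divide power_mult)
  have c1: "79/350 / (t / (1 + s)^2) = \<sigma> * (79/350 * u * (1 + s)^2)"
    using *[of "79/350" 1] by (simp add: u1)
  have c2: "\<sigma> * (87/875) / (t / (1 + s)^2)^2 = \<sigma> * (87/875 * u^2 * (1 + s)^4)"
    using *[of "\<sigma> * (87/875)" 2] \<sigma>2 unfolding u1 by (simp add: power2_eq_square mult_ac)
  have c3: "91543/1347500 / (t / (1 + s)^2)^3 = \<sigma> * (91543/1347500 * u^3 * (1 + s)^6)"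
    using *[of "91543/1347500" 3] \<sigma> unfolding u1 by auto
  have "fatou \<sigma> (t / (1 + s)^2) - t - \<sigma> * C =
     \<sigma> * (- 2 * v + 3 * u * v^2 - 4 * u^2 * v^3 + 5 * u^3 * v^4 - u^4 * (v^5 * (6 + 5 * s) / (1 + s)^2)
       - l + 6/5 * (s - s^2/2 + s^3/3 + log_remainder s)
       + 79/350 * u * (1 + s)^2 + 87/875 * u^2 * (1 + s)^4 + 91543/1347500 * u^3 * (1 + s)^6)"
    unfolding fatou_def ln c1 c2 c3 unfolding tinv l_def by (simp add: algebra_simps)
  also have "- 2 * v + 3 * u * v^2 - 4 * u^2 * v^3 + 5 * u^3 * v^4 - u^4 * J
       - l + 6/5 * (s - s^2/2 + s^3/3 + r)
       + 79/350 * u * (1 + s)^2 + 87/875 * u^2 * (1 + s)^4 + 91543/1347500 * u^3 * (1 + s)^6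
     = inversion_defect l u v + u^4 * (87/875 * v^2 * (6 + 4 * s + s^2)
        + 91543/1347500 * v * (6 + 15 * s + 20 * s^2 + 15 * s^3 + 6 * s^4 + s^5) - J) + 6/5 * r" for J r
    unfolding inversion_defect_def s_def by algebra
  finally show ?thesis by (simp only: s_def)
qed

section \<open>Functions growing slower than every power\<close>

text \<open>
  The coefficients of the expansion are polynomials in \<open>ln n\<close>. For error bounds only
  the power of \<open>1 / n\<close> in front of them matters; functions of order below every positive power are
  closed under the ring operations, so that the degrees in \<open>ln n\<close> need not be counted.
\<close>
definition subpolynomial :: "(real \<Rightarrow> real) \<Rightarrow> bool" where
  "subpolynomial f \<longleftrightarrow> (\<forall>\<delta>>0. f \<in> O[at_top](\<lambda>t. t powr \<delta>))"

lemma subpolynomial_bounded: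
  assumes "f \<in> O[at_top](\<lambda>_. 1)"
  shows "subpolynomial f"
  unfolding subpolynomial_def
proof (intro allI impI)
  fix \<delta> :: real assume "\<delta> > 0"
  then have "(\<lambda>_. 1) \<in> O[at_top](\<lambda>t::real. t powr \<delta>)" by real_asymp
  with assms show "f \<in> O[at_top](\<lambda>t. t powr \<delta>)" using landau_o.big_trans by blast
qed

lemma subpolynomial_const: "subpolynomial (\<lambda>_. c)"
  by (rule subpolynomial_bounded) simp

lemma subpolynomial_ln: "subpolynomial ln"
  unfolding subpolynomial_def
proof (intro allI impI)
  fix \<delta> :: real assume "\<delta> > 0"
  then show "ln \<in> O[at_top](\<lambda>t::real. t powr \<delta>)" by real_asymp
qed

lemma subpolynomial_add: "subpolynomial f \<Longrightarrow> subpolynomial g \<Longrightarrow> subpolynomial (\<lambda>t. f t + g t)"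
  unfolding subpolynomial_def by (auto intro: sum_in_bigo)

lemma subpolynomial_diff: "subpolynomial f \<Longrightarrow> subpolynomial g \<Longrightarrow> subpolynomial (\<lambda>t. f t - g t)"
  unfolding subpolynomial_def by (auto intro: sum_in_bigo)

lemma subpolynomial_mult:
  assumes "subpolynomial f" "subpolynomial g"
  shows "subpolynomial (\<lambda>t. f t * g t)"
  unfolding subpolynomial_def
proof (intro allI impI)
  fix \<delta> :: real assume "\<delta> > 0"
  then have "(\<lambda>t. f t * g t) \<in> O[at_top](\<lambda>t. t powr (\<delta>/2) * t powr (\<delta>/2))"
    using assms unfolding subpolynomial_def by (intro landau_o.big.mult) auto
  then show "(\<lambda>t. f t * g t) \<in> O[at_top](\<lambda>t. t powr \<delta>)"
    by (simp flip: powr_add)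
qed

lemma subpolynomial_power: "subpolynomial f \<Longrightarrow> subpolynomial (\<lambda>t. f t ^ k)"
  by (induction k) (auto intro: subpolynomial_const subpolynomial_mult)

lemma subpolynomial_poly: "subpolynomial f \<Longrightarrow> subpolynomial (\<lambda>t. poly p (f t))"
  by (induction p) (auto intro: subpolynomial_const subpolynomial_add subpolynomial_mult)

lemmas subpolynomial_intros = subpolynomial_const subpolynomial_ln subpolynomial_add subpolynomial_diff
  subpolynomial_mult subpolynomial_power subpolynomial_poly

lemma subpolynomial_times_inverse_power:
  assumes "subpolynomial f" "j < k"
  shows "(\<lambda>t. (1 / t) ^ k * f t) \<in> o[at_top](\<lambda>t. 1 / t ^ j)"
proof -
  have "f \<in> O[at_top](\<lambda>t. t powr (1/2))" using assms(1) by (simp add: subpolynomial_def)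
  then have "(\<lambda>t. (1 / t) ^ k * f t) \<in> O[at_top](\<lambda>t. (1 / t) ^ k * t powr (1/2))"
    by (intro landau_o.big.mult) auto
  also have "(\<lambda>t::real. (1 / t) ^ k * t powr (1/2)) \<in> o[at_top](\<lambda>t. 1 / t ^ j)"
    using assms(2) by real_asymp
  finally show ?thesis .
qed

lemma log_remainder_bigo:
  assumes "(g \<longlongrightarrow> 0) F"
  shows "(\<lambda>x. log_remainder (g x)) \<in> O[F](\<lambda>x. g x ^ 4)"
proof -
  have "log_remainder \<in> O[at 0](\<lambda>s. s^4)"
    unfolding log_remainder_def[abs_def] by real_asymp
  then obtain K where "eventually (\<lambda>s. norm (log_remainder s) \<le> K * norm (s^4)) (at 0)"
    by (rule landau_o.bigE)
  then have "eventually (\<lambda>s. norm (log_remainder s) \<le> K * norm (s^4)) (nhds 0)"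
    unfolding eventually_at_filter
  proof (rule eventually_mono)
    fix s :: real
    assume "s \<noteq> 0 \<longrightarrow> s \<in> UNIV \<longrightarrow> norm (log_remainder s) \<le> K * norm (s^4)"
    then show "norm (log_remainder s) \<le> K * norm (s^4)"
      by (cases "s = 0") (simp_all add: log_remainder_def)
  qed
  from eventually_compose_filterlim[OF this assms]
  show ?thesis by (rule bigoI)
qed

text \<open>
  With \<open>u = \<sigma> / t\<close> all contributions to the error have the form \<open>u^4\<close> times a subpolynomial
  function: the defect by the choice of the polynomials \<open>P\<close>, the rest by the orders of the Taylor
  remainders.
\<close>
lemma fatou_inverse_expansion:
  fixes \<sigma> C :: real
  assumes \<sigma>: "\<sigma> = 1 \<or> \<sigma> = -1"
  defines "p \<equiv> \<lambda>t. 1 + \<sigma> / t * correction (3/5 * ln t + C) (\<sigma> / t)"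
  shows "(\<lambda>t. fatou \<sigma> (t / (p t)^2) - t - \<sigma> * C) \<in> o[at_top](\<lambda>t. 1 / t^3)"
    and "(p \<longlongrightarrow> 1) at_top"
proof -
  define l where "l t = 3/5 * ln t + C" for t
  define u where "u t = \<sigma> / t" for t
  define a where "a m t = poly (kindred_P m) (- (1/2) * l t)" for m t
  define w2 where "w2 t = a 3 t + u t * a 4 t" for t
  define w1 where "w1 t = a 2 t + u t * w2 t" for t
  define v where "v t = correction (l t) (u t)" for t
  have p: "p t = 1 + u t * v t" for t by (simp add: p_def u_def v_def l_def)
  have p_fun: "p = (\<lambda>t. 1 + u t * v t)" by (simp add: fun_eq_iff p)
  have sl: "subpolynomial l" unfolding l_def[abs_def] by (intro subpolynomial_intros)
  have su: "subpolynomial u"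
    unfolding u_def[abs_def] by (rule subpolynomial_bounded) real_asymp
  have sa: "subpolynomial (a m)" for m
    unfolding a_def[abs_def] by (intro subpolynomial_intros sl)
  have sw2: "subpolynomial w2" unfolding w2_def[abs_def] by (intro subpolynomial_intros sa su)
  have sw1: "subpolynomial w1" unfolding w1_def[abs_def] by (intro subpolynomial_intros sa su sw2)
  have v: "v = (\<lambda>t. a 1 t + u t * w1 t)"
    by (simp add: fun_eq_iff v_def w1_def w2_def correction_def a_def)
  have sv: "subpolynomial v" unfolding v by (intro subpolynomial_intros sa su sw1)
  have "(\<lambda>t. (1 / t)^1 * (\<sigma> * v t)) \<in> o[at_top](\<lambda>t. 1 / t^0)"
    by (intro subpolynomial_times_inverse_power subpolynomial_intros sv) simp
  then have lim: "((\<lambda>t. u t * v t) \<longlongrightarrow> 0) at_top"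
    by (auto simp: u_def dest: smalloD_tendsto)
  then show plim: "(p \<longlongrightarrow> 1) at_top"
    using tendsto_add[OF tendsto_const lim, of 1] by (simp add: p_fun)
  have "((\<lambda>t. 1 / (1 + u t * v t)^2) \<longlongrightarrow> 1) at_top"
    using tendsto_divide[OF tendsto_const[of 1] tendsto_power[OF plim, of 2]] by (simp add: p)
  then have sinv: "subpolynomial (\<lambda>t. 1 / (1 + u t * v t)^2)"
    by (intro subpolynomial_bounded bigoI_tendsto) auto
  define Q where "Q t = a 4 t * (6 * a 1 t + 6/5) + 3 * w2 t * (w1 t + a 2 t)
      + w2 t * (- 4 * (v t^2 + v t * a 1 t + a 1 t^2) - 3/5 * (v t + a 1 t) + 79/175)
      + a 2 t * w1 t * (- 4 * (v t + 2 * a 1 t) - 3/5)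
      + w1 t * (5 * (v t^3 + v t^2 * a 1 t + v t * a 1 t^2 + a 1 t^3)
          + 2/5 * (v t^2 + v t * a 1 t + a 1 t^2) + 79/350 * (v t + a 1 t) + 348/875)" for t
  define R where "R t = 87/875 * v t^2 * (6 + 4 * (u t * v t) + (u t * v t)^2)
        + 91543/1347500 * v t * (6 + 15 * (u t * v t) + 20 * (u t * v t)^2 + 15 * (u t * v t)^3
            + 6 * (u t * v t)^4 + (u t * v t)^5)
        - v t^5 * (6 + 5 * (u t * v t)) / (1 + u t * v t)^2" for t
  have sQ: "subpolynomial Q" unfolding Q_def[abs_def] by (intro subpolynomial_intros sa sv su sw1 sw2)
  have "subpolynomial (\<lambda>t. v t^5 * (6 + 5 * (u t * v t)))" by (intro subpolynomial_intros sv su)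
  from subpolynomial_mult[OF this sinv]
  have "subpolynomial (\<lambda>t. v t^5 * (6 + 5 * (u t * v t)) / (1 + u t * v t)^2)" by simp
  then have sR: "subpolynomial R" unfolding R_def[abs_def] by (intro subpolynomial_intros sv su)
  have u4: "u t ^ 4 = (1 / t)^4" for t using \<sigma> by (auto simp: u_def power_divide)
  have 1: "(\<lambda>t. \<sigma> * ((1 / t)^4 * (Q t + R t))) \<in> o[at_top](\<lambda>t. 1 / t^3)"
    using subpolynomial_times_inverse_power[OF subpolynomial_add[OF sQ sR], of 3 4] \<sigma> by auto
  have "(\<lambda>t. log_remainder (u t * v t)) \<in> O[at_top](\<lambda>t. (1 / t)^4 * v t ^ 4)"
    using log_remainder_bigo[OF lim] by (simp add: power_mult_distrib u4)
  also have "(\<lambda>t. (1 / t)^4 * v t ^ 4) \<in> o[at_top](\<lambda>t. 1 / t^3)"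
    by (intro subpolynomial_times_inverse_power subpolynomial_intros sv) simp
  finally have 2: "(\<lambda>t. \<sigma> * (6/5 * log_remainder (u t * v t))) \<in> o[at_top](\<lambda>t. 1 / t^3)"
    using \<sigma> by auto
  have "eventually (\<lambda>t. p t > 0) at_top"
    using order_tendstoD(1)[OF plim, of 0] by simp
  with eventually_gt_at_top[of 0]
  have "eventually (\<lambda>t. fatou \<sigma> (t / (p t)^2) - t - \<sigma> * C
      = \<sigma> * ((1 / t)^4 * (Q t + R t)) + \<sigma> * (6/5 * log_remainder (u t * v t))) at_top"
  proof eventually_elim
    case (elim t)
    have "inversion_defect (l t) (u t) (v t) = u t^4 * Q t"
      using inversion_defect_correction[of "l t" "u t"] unfolding Q_def w1_def w2_def v_def a_def .
    with fatou_at_candidate[OF \<sigma>, of t "v t" C] elim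
    have "fatou \<sigma> (t / (p t)^2) - t - \<sigma> * C = \<sigma> * (u t^4 * Q t + u t^4 * R t + 6/5 * log_remainder (u t * v t))"
      unfolding p l_def[symmetric] u_def[symmetric] R_def by simp
    then show ?case by (simp only: u4 distrib_left)
  qed
  from landau_o.small.in_cong[OF this] sum_in_smallo(1)[OF 1 2]
  show "(\<lambda>t. fatou \<sigma> (t / (p t)^2) - t - \<sigma> * C) \<in> o[at_top](\<lambda>t. 1 / t^3)" by simp
qed

section \<open>From the Fatou coordinate back to the orbit\<close>

lemma inverse_sqrt_lipschitz:
  fixes a b c :: real
  assumes "c > 0" "a \<ge> c" "b \<ge> c"
  shows "\<bar>1 / sqrt a - 1 / sqrt b\<bar> \<le> \<bar>a - b\<bar> / (c * sqrt c)"
proof -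
  have pos: "sqrt a > 0" "sqrt b > 0" "sqrt c > 0" using assms by simp_all
  have le: "sqrt a \<ge> sqrt c" "sqrt b \<ge> sqrt c" "sqrt b + sqrt a \<ge> sqrt c"
    using assms pos add_increasing[of "sqrt b" "sqrt c" "sqrt a"] by simp_all
  have "1 / sqrt a - 1 / sqrt b = (sqrt b - sqrt a) / (sqrt a * sqrt b)"
    using pos by (simp add: field_simps)
  also have "\<dots> = ((sqrt b - sqrt a) * (sqrt b + sqrt a)) / (sqrt a * sqrt b * (sqrt b + sqrt a))"
    using add_pos_pos[OF pos(2,1)] by simp
  also have "(sqrt b - sqrt a) * (sqrt b + sqrt a) = b - a"
    using assms by (simp add: algebra_simps)
  finally have "\<bar>1 / sqrt a - 1 / sqrt b\<bar> = \<bar>a - b\<bar> / (sqrt a * sqrt b * (sqrt b + sqrt a))"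
    using pos by (simp add: abs_divide abs_minus_commute abs_mult)
  also have "\<dots> \<le> \<bar>a - b\<bar> / (sqrt c * sqrt c * sqrt c)"
  proof (rule divide_left_mono)
    show "sqrt c * sqrt c * sqrt c \<le> sqrt a * sqrt b * (sqrt b + sqrt a)"
      using le pos by (intro mult_mono[OF mult_mono]) (simp_all only: less_imp_le mult_nonneg_nonneg)
    show "0 < sqrt a * sqrt b * (sqrt b + sqrt a) * (sqrt c * sqrt c * sqrt c)"
      using pos by (simp only: mult_pos_pos add_pos_pos)
  qed simp
  also have "sqrt c * sqrt c * sqrt c = c * sqrt c" using assms by simp
  finally show ?thesis .
qed

text \<open>
  Both the orbit \<open>V n = 3 / (x n)^2\<close> and the candidate \<open>W n = n / p^2\<close> have Fatou coordinate
  \<open>n + L + o(n^-3)\<close>, so they differ by \<open>o(n^-3)\<close>. Both are at least \<open>n / 8\<close>, which controls the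
  inverse square roots.
\<close>
lemma kindred_orbit_expansion:
  fixes x :: "nat \<Rightarrow> real"
  assumes \<sigma>: "\<sigma> = 1 \<or> \<sigma> = -1"
    and pos: "\<And>n. x n > 0" and lim: "x \<longlonglongrightarrow> 0"
    and inc: "(\<lambda>n. fatou \<sigma> (3 / (x (Suc n))^2) - fatou \<sigma> (3 / (x n)^2) - 1) \<in> O(\<lambda>n. x n ^ 10)"
  shows "\<exists>C. (\<lambda>n. x n / sqrt 3 - 1 / real n powr (1/2) *
      (1 + (\<Sum>m=1..4. poly (kindred_P m) (- (1/2) * (3/5 * ln (real n) + C)) * (\<sigma> / real n) ^ m)))
    \<in> o(\<lambda>n. 1 / real n powr (9/2))"
proof -
  obtain L where L: "(\<lambda>n. fatou \<sigma> (3 / (x n)^2) - real n - L) \<in> O(\<lambda>n. 1 / real n ^ 4)"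
    using fatou_orbit(1)[OF assms] by blast
  define C where "C = \<sigma> * L"
  have C: "\<sigma> * C = L" using \<sigma> by (auto simp: C_def)
  define p where "p t = 1 + \<sigma> / t * correction (3/5 * ln t + C) (\<sigma> / t)" for t
  define V where "V n = 3 / (x n)^2" for n
  define W where "W n = real n / (p (real n))^2" for n
  note fr = filterlim_real_sequentially
  have cand: "(\<lambda>n. fatou \<sigma> (W n) - real n - L) \<in> o(\<lambda>n. 1 / real n ^ 3)"
    using landau_o.small.compose[OF fatou_inverse_expansion(1)[OF \<sigma>, of C] fr]
    unfolding W_def p_def C .
  have plim: "(\<lambda>n. p (real n)) \<longlonglongrightarrow> 1"
    using filterlim_compose[OF fatou_inverse_expansion(2)[OF \<sigma>, of C] fr] unfolding p_def .
  have "(\<lambda>n. 1 / real n ^ 4) \<in> o(\<lambda>n. 1 / real n ^ 3)" by real_asymp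
  from landau_o.big_small_trans[OF L this]
  have "(\<lambda>n. fatou \<sigma> (V n) - real n - L) \<in> o(\<lambda>n. 1 / real n ^ 3)" by (simp add: V_def)
  from sum_in_smallo(2)[OF this cand]
  have diff: "(\<lambda>n. fatou \<sigma> (V n) - fatou \<sigma> (W n)) \<in> o(\<lambda>n. 1 / real n ^ 3)" by simp
  have large: "eventually (\<lambda>n. n \<ge> 16 \<and> p (real n) > 0 \<and> V n \<ge> real n / 8 \<and> W n \<ge> real n / 8) at_top"
    using eventually_ge_at_top[of 16] fatou_orbit(2)[OF assms]
      order_tendstoD(1)[OF plim, of 0, OF zero_less_one] order_tendstoD(2)[OF plim, of 2, simplified]
  proof eventually_elim
    case (elim n)
    have "(p (real n))^2 \<le> 2^2" using elim by (intro power_mono) auto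
    then have "real n / 8 \<le> real n / (p (real n))^2"
      using elim by (intro divide_left_mono) auto
    then show ?case using elim by (simp add: V_def W_def)
  qed
  have "eventually (\<lambda>n. norm (V n - W n) \<le> 3 * norm (fatou \<sigma> (V n) - fatou \<sigma> (W n))) at_top"
    using large
  proof eventually_elim
    case (elim n)
    then have "real n \<ge> 16" by simp
    with elim have "V n \<ge> 2" "W n \<ge> 2" by linarith+
    then show ?case using fatou_bilipschitz(1)[OF \<sigma>, of "V n" "W n"] by simp
  qed
  from landau_o.big_small_trans[OF bigoI[OF this] diff]
  have VW: "(\<lambda>n. V n - W n) \<in> o(\<lambda>n. 1 / real n ^ 3)" .
  have "eventually (\<lambda>n. norm (x n / sqrt 3 - p (real n) / sqrt (real n))
      \<le> 1 * norm ((V n - W n) * (1 / (real n / 8 * sqrt (real n / 8))))) at_top"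
    using large
  proof eventually_elim
    case (elim n)
    then have n: "real n > 0" by simp
    have scale: "norm (D * (1 / d)) = \<bar>D\<bar> / d" if "d > 0" for D d :: real
      using that by (simp add: abs_mult)
    have d: "real n / 8 * sqrt (real n / 8) > 0" using n by simp
    have "1 / sqrt (V n) = x n / sqrt 3"
      using pos[of n] by (simp add: V_def real_sqrt_divide)
    moreover have "1 / sqrt (W n) = p (real n) / sqrt (real n)"
      using elim n by (simp add: W_def real_sqrt_divide)
    ultimately show ?case
      using inverse_sqrt_lipschitz[of "real n / 8" "V n" "W n"] elim n
      unfolding scale[OF d] by simp
  qed
  then have "(\<lambda>n. x n / sqrt 3 - p (real n) / sqrt (real n))
      \<in> O(\<lambda>n. (V n - W n) * (1 / (real n / 8 * sqrt (real n / 8))))"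
    by (rule bigoI)
  also have "(\<lambda>n. (V n - W n) * (1 / (real n / 8 * sqrt (real n / 8))))
      \<in> o(\<lambda>n. 1 / real n ^ 3 * (1 / (real n / 8 * sqrt (real n / 8))))"
    by (intro landau_o.small_big_mult VW landau_o.big_refl)
  also have "(\<lambda>n. 1 / real n ^ 3 * (1 / (real n / 8 * sqrt (real n / 8)))) \<in> O(\<lambda>n. 1 / real n powr (9/2))"
    by real_asymp
  finally have fin: "(\<lambda>n. x n / sqrt 3 - p (real n) / sqrt (real n)) \<in> o(\<lambda>n. 1 / real n powr (9/2))" .
  have "x n / sqrt 3 - p (real n) / sqrt (real n) = x n / sqrt 3 - 1 / real n powr (1/2) *
      (1 + (\<Sum>m=1..4. poly (kindred_P m) (- (1/2) * (3/5 * ln (real n) + C)) * (\<sigma> / real n) ^ m))" for n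
    unfolding p_def correction_eq_sum by (simp add: powr_half_sqrt)
  with fin show ?thesis by (auto simp only:)
qed

lemma contracting_orbit:
  fixes f :: "real \<Rightarrow> real" and x :: "nat \<Rightarrow> real"
  assumes cont: "\<And>t. isCont f t"
    and f: "\<And>t. 0 < t \<Longrightarrow> t < \<epsilon> \<Longrightarrow> 0 < f t \<and> f t < t"
    and x0: "0 < x 0" "x 0 < \<epsilon>" and x: "\<And>n. x (Suc n) = f (x n)"
  shows "x n > 0" "x (Suc n) < x n" "x \<longlonglongrightarrow> 0"
proof -
  have bounds: "0 < x n \<and> x n < \<epsilon>" for n
  proof (induction n)
    case (Suc n)
    with f[of "x n"] show ?case by (simp add: x)
  qed (use x0 in simp)
  then show "x n > 0" "x (Suc n) < x n" for n using f[of "x n"] by (simp_all add: x)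
  then have dec: "decseq x" by (intro decseq_SucI less_imp_le)
  obtain L where L: "x \<longlonglongrightarrow> L" "\<forall>n. L \<le> x n"
    using decseq_convergent[OF dec, of 0] bounds less_imp_le by metis
  have "L \<ge> 0" by (rule LIMSEQ_le_const[OF L(1)]) (use bounds less_imp_le in blast)
  have "(\<lambda>n. x (Suc n)) \<longlonglongrightarrow> f L"
    unfolding x by (rule isCont_tendsto_compose[OF cont L(1)])
  then have "f L = L" using LIMSEQ_Suc[OF L(1)] LIMSEQ_unique by blast
  moreover have "L < \<epsilon>" using L(2) x0(2) by (meson order_le_less_trans)
  ultimately have "L = 0" using f[of L] \<open>L \<ge> 0\<close> by force
  with L(1) show "x \<longlonglongrightarrow> 0" by simp
qed

text \<open>
  The hypothesis forces \<open>\<epsilon> \<le> pi\<close>, so \<open>sin\<close> is positive on the interval, and the orbit decreases to the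
  fixed point 0.
\<close>
lemma sin_orbit_expansion:
  fixes x :: "nat \<Rightarrow> real"
  assumes \<epsilon>: "\<And>t. 0 < t \<Longrightarrow> t < \<epsilon> \<Longrightarrow> sin t \<noteq> 0 \<and> sin t \<noteq> t"
    and x0: "0 < x 0" "x 0 < \<epsilon>" and x: "\<And>n. x (Suc n) = sin (x n)"
  shows "\<exists>C. (\<lambda>n. x n / sqrt 3 - 1 / real n powr (1/2) *
      (1 + (\<Sum>m=1..4. poly (kindred_P m) (- (1/2) * (3/5 * ln (real n) + C)) * (1 / real n) ^ m)))
    \<in> o(\<lambda>n. 1 / real n powr (9/2))"
proof -
  have "\<epsilon> \<le> pi" using \<epsilon>[of pi] by (metis not_le pi_gt_zero sin_pi)
  have f: "0 < sin t \<and> sin t < t" if "0 < t" "t < \<epsilon>" for t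
    using \<epsilon>[OF that] sin_gt_zero[of t] sin_x_le_x[of t] that \<open>\<epsilon> \<le> pi\<close> by (simp add: less_le)
  note orbit = contracting_orbit[OF isCont_sin f x0 x]
  have "filterlim x (at_right 0) at_top"
    using orbit(3) by (simp add: filterlim_at orbit(1) orbit(1)[THEN less_imp_neq, THEN not_sym])
  from landau_o.big.compose[OF fatou_increment[OF _ sin_step] this]
  have "(\<lambda>n. fatou 1 (3 / (x (Suc n))^2) - fatou 1 (3 / (x n)^2) - 1) \<in> O(\<lambda>n. x n ^ 10)"
    by (simp add: x)
  with kindred_orbit_expansion[of 1 x] orbit(1,3) show ?thesis by blast
qed

text \<open>
  Read backwards, an \<open>arsinh\<close> step is a \<open>sinh\<close> step from \<open>x (Suc n)\<close> to \<open>x n\<close>. That step changes the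
  Fatou coordinate by about - 1, so the \<open>arsinh\<close> step changes it by about 1.
\<close>
lemma arsinh_orbit_expansion:
  fixes x :: "nat \<Rightarrow> real"
  assumes \<epsilon>: "\<And>t. 0 < t \<Longrightarrow> t < \<epsilon> \<Longrightarrow> arsinh t \<noteq> t"
    and x0: "0 < x 0" "x 0 < \<epsilon>" and x: "\<And>n. x (Suc n) = arsinh (x n)"
  shows "\<exists>C. (\<lambda>n. x n / sqrt 3 - 1 / real n powr (1/2) *
      (1 + (\<Sum>m=1..4. poly (kindred_P m) (- (1/2) * (3/5 * ln (real n) + C)) * (- 1 / real n) ^ m)))
    \<in> o(\<lambda>n. 1 / real n powr (9/2))"
proof -
  have f: "0 < arsinh t \<and> arsinh t < t" if t: "0 < t" "t < \<epsilon>" for t :: real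
  proof -
    have pos: "arsinh t > 0" using t by simp
    have deriv: "(sinh has_real_derivative cosh z) (at z)" for z :: real
      by (auto intro!: derivative_eq_intros)
    obtain z where z: "sinh (arsinh t) - sinh 0 = (arsinh t - 0) * cosh z"
      using MVT2[OF pos, of sinh cosh] deriv by blast
    have "arsinh t * 1 \<le> arsinh t * cosh z"
      by (rule mult_left_mono[OF cosh_real_ge_1 less_imp_le[OF pos]])
    with z have "arsinh t \<le> t" by simp
    then show ?thesis using pos \<epsilon>[OF t] by (simp add: less_le)
  qed
  have cont: "isCont arsinh t" for t :: real by (rule isCont_arsinh)
  note orbit = contracting_orbit[OF cont f x0 x]
  have lim: "filterlim (\<lambda>n. x (Suc n)) (at_right 0) at_top"
    using LIMSEQ_Suc[OF orbit(3)] by (simp add: filterlim_at orbit(1) orbit(1)[THEN less_imp_neq, THEN not_sym])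
  have sinh: "sinh (x (Suc n)) = x n" for n by (simp add: x)
  from landau_o.big.compose[OF fatou_increment[OF _ sinh_step] lim]
  have "(\<lambda>n. fatou (-1) (3 / (x n)^2) - fatou (-1) (3 / (x (Suc n))^2) - (-1)) \<in> O(\<lambda>n. x (Suc n) ^ 10)"
    unfolding sinh by simp
  then have "(\<lambda>n. - (fatou (-1) (3 / (x n)^2) - fatou (-1) (3 / (x (Suc n))^2) - (-1))) \<in> O(\<lambda>n. x (Suc n) ^ 10)"
    by (simp only: landau_o.big.uminus_in_iff)
  also have "(\<lambda>n. - (fatou (-1) (3 / (x n)^2) - fatou (-1) (3 / (x (Suc n))^2) - (-1)))
    = (\<lambda>n. fatou (-1) (3 / (x (Suc n))^2) - fatou (-1) (3 / (x n)^2) - 1)" by (simp add: fun_eq_iff)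
  also have "(\<lambda>n. x (Suc n) ^ 10) \<in> O(\<lambda>n. x n ^ 10)"
    using orbit(1,2) by (intro landau_o.big_mono always_eventually allI)
      (simp add: power_mono less_imp_le)
  finally show ?thesis using kindred_orbit_expansion[of "-1" x] orbit(1,3) by blast
qed

theorem mainTheorem2:
  shows
    "(\<forall>(\<epsilon>::real) (x0::real) (x::nat \<Rightarrow> real).
        \<epsilon> > 0 \<and> (\<forall>t. 0 < t \<and> t < \<epsilon> \<longrightarrow> sin t \<noteq> 0 \<and> sin t \<noteq> t) \<and>
        0 < x0 \<and> x0 < \<epsilon> \<and>
        x 0 = x0 \<and> (\<forall>n\<ge>1. x n = sin (x (n - 1))) \<longrightarrow>
        (\<exists>C::real.
          (\<lambda>n. x n / sqrt 3 -
               1 / real n powr (1/2) *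
                 (1 + (\<Sum>m=1..4. poly (kindred_P m) (- (1/2) * (3/5 * ln (real n) + C)) * (1 / real n ^ m))))
            \<in> o(\<lambda>n. 1 / real n powr (9/2)))) \<and>
     (\<forall>(\<epsilon>::real) (x0::real) (x::nat \<Rightarrow> real).
        \<epsilon> > 0 \<and> (\<forall>t. 0 < t \<and> t < \<epsilon> \<longrightarrow> arsinh t \<noteq> 0 \<and> arsinh t \<noteq> t) \<and>
        0 < x0 \<and> x0 < \<epsilon> \<and>
        x 0 = x0 \<and> (\<forall>n\<ge>1. x n = arsinh (x (n - 1))) \<longrightarrow>
        (\<exists>C::real.
          (\<lambda>n. x n / sqrt 3 -
               1 / real n powr (1/2) *
                 (1 + (\<Sum>m=1..4. poly (kindred_R m) (1/2 * (3/5 * ln (real n) + C)) * (1 / real n ^ m))))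
            \<in> o(\<lambda>n. 1 / real n powr (9/2))))"
proof (intro conjI allI impI)
  fix \<epsilon> x0 :: real and x :: "nat \<Rightarrow> real"
  assume asm: "\<epsilon> > 0 \<and> (\<forall>t. 0 < t \<and> t < \<epsilon> \<longrightarrow> sin t \<noteq> 0 \<and> sin t \<noteq> t) \<and>
        0 < x0 \<and> x0 < \<epsilon> \<and> x 0 = x0 \<and> (\<forall>n\<ge>1. x n = sin (x (n - 1)))"
  then have "x (Suc n) = sin (x n)" for n by (metis diff_Suc_1 le_add1 plus_1_eq_Suc)
  with asm have "\<exists>C. (\<lambda>n. x n / sqrt 3 - 1 / real n powr (1/2) *
      (1 + (\<Sum>m=1..4. poly (kindred_P m) (- (1/2) * (3/5 * ln (real n) + C)) * (1 / real n) ^ m)))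
    \<in> o(\<lambda>n. 1 / real n powr (9/2))"
    by (intro sin_orbit_expansion[of \<epsilon>]) auto
  then show "\<exists>C::real. (\<lambda>n. x n / sqrt 3 - 1 / real n powr (1/2) *
      (1 + (\<Sum>m=1..4. poly (kindred_P m) (- (1/2) * (3/5 * ln (real n) + C)) * (1 / real n ^ m))))
    \<in> o(\<lambda>n. 1 / real n powr (9/2))"
    by (simp only: power_one_over)
next
  fix \<epsilon> x0 :: real and x :: "nat \<Rightarrow> real"
  assume asm: "\<epsilon> > 0 \<and> (\<forall>t. 0 < t \<and> t < \<epsilon> \<longrightarrow> arsinh t \<noteq> 0 \<and> arsinh t \<noteq> t) \<and>
        0 < x0 \<and> x0 < \<epsilon> \<and> x 0 = x0 \<and> (\<forall>n\<ge>1. x n = arsinh (x (n - 1)))"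
  then have "x (Suc n) = arsinh (x n)" for n by (metis diff_Suc_1 le_add1 plus_1_eq_Suc)
  with asm have "\<exists>C. (\<lambda>n. x n / sqrt 3 - 1 / real n powr (1/2) *
      (1 + (\<Sum>m=1..4. poly (kindred_P m) (- (1/2) * (3/5 * ln (real n) + C)) * (- 1 / real n) ^ m)))
    \<in> o(\<lambda>n. 1 / real n powr (9/2))"
    by (intro arsinh_orbit_expansion[of \<epsilon>]) auto
  moreover have "poly (kindred_P m) (- (1/2) * y) * (- 1 / real n) ^ m
      = poly (kindred_R m) (1/2 * y) * (1 / real n ^ m)" for m n y
    unfolding poly_kindred_R power_divide by simp
  ultimately show "\<exists>C::real. (\<lambda>n. x n / sqrt 3 - 1 / real n powr (1/2) *
      (1 + (\<Sum>m=1..4. poly (kindred_R m) (1/2 * (3/5 * ln (real n) + C)) * (1 / real n ^ m))))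
    \<in> o(\<lambda>n. 1 / real n powr (9/2))"
    by (simp only:)
qed

end
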